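(* Let $X$ and $Y$ be Banach spaces, $\alpha\in(0,1]$, $M\subseteq X$ an $n$-dimensional differentiable manifold that is $\alpha$-Hölder in $X$, and $K\subseteq M$ a compact set. Let $F\in C^1(M,Y)$ satisfy: (1) $F$ is injective; (2) the differential $dF_x\colon T_xM\to Y$ is injective for every $x\in M$. Then there exists a constant $C>0$ such that $$\|x-y\|_X\le C\,\|F(x)-F(y)\|_Y^{\alpha},\qquad x,y\in K.$$
   Context: A subset $M$ of a Banach space $X$ is an $n$-dimensional differentiable manifold in $X$ if there is an atlas $\{(U_i,\varphi_i)\}_{i\in I}$ with $U_i\subseteq M$, $\bigcup_{i}U_i=M$, $\varphi_i\colon U_i\to\mathbb{R}^n$, such that: (i) each $U_i$ is open in $M$ (topology inherited from $X$) and $\varphi_i(U_i)$ is open in $\mathbb{R}^n$; (ii) each $\varphi_i$ is a homeomorphism onto $\varphi_i(U_i)$; (iii) all transition maps $\varphi_j\circ\varphi_i^{-1}\colon\varphi_i(U_i\cap U_j)\to\varphi_j(U_i\cap U_j)$ are continuously differentiable. (No differentiability of $\varphi_i^{-1}$ as a map into $X$ is required.) $M$ (with its atlas) is $\alpha$-Hölder in $X$, $\alpha\in(0,1]$, if there is $\ell\in(0,1]$ such that for every $i\in I$ and all distinct $x,y\in U_i$: $\frac{|\varphi_i(x)-\varphi_i(y)|^\alpha}{\|x-y\|_X}\ge\ell$. A map $F\colon M\to Y$ into a Banach space is in $C^1(M,Y)$ if for every $i\in I$ the map $F\circ\varphi_i^{-1}\colon\varphi_i(U_i)\to Y$ is Fréchet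 differentiable with continuous derivative $(F\circ\varphi_i^{-1})'\colon\varphi_i(U_i)\to\mathcal{L}(\mathbb{R}^n,Y)$. The tangent space $T_xM$ is identified with $\mathbb{R}^n$ via a chart $(U_i,\varphi_i)$ with $x\in U_i$, and the differential is $dF_x h=(F\circ\varphi_i^{-1})'(\varphi_i(x))h$, $h\in\mathbb{R}^n$; its injectivity and its range do not depend on the chart chosen. *)

theory Defs
  imports "HOL-Analysis.Analysis"
begin

text \<open>Only used for open sets \<open>S\<close>. The type \<open>'a \<Rightarrow>\<^sub>L 'b\<close> carries the operator norm.\<close>

definition C1_on :: "('a::real_normed_vector \<Rightarrow> 'b::real_normed_vector) \<Rightarrow> 'a set \<Rightarrow> bool" where
  "C1_on f S \<longleftrightarrow>
     (\<exists>f' :: 'a \<Rightarrow> 'a \<Rightarrow>\<^sub>L 'b.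
        (\<forall>x\<in>S. (f has_derivative blinfun_apply (f' x)) (at x)) \<and> continuous_on S f')"

text \<open>The charts are \<open>\<phi> i\<close> on \<open>U i\<close> for \<open>i \<in> I\<close>; values of \<open>\<phi> i\<close> outside \<open>U i\<close> are
  irrelevant, and \<open>inv_into (U i) (\<phi> i)\<close> is the inverse chart. The inverse chart need
  not be differentiable as a map into the ambient space.\<close>

definition differentiable_manifold ::
    "'a::banach set \<Rightarrow> 'i set \<Rightarrow> ('i \<Rightarrow> 'a set) \<Rightarrow> ('i \<Rightarrow> 'a \<Rightarrow> real ^ 'n) \<Rightarrow> bool" where
  "differentiable_manifold M I U \<phi> \<longleftrightarrow>
     (\<Union>i\<in>I. U i) = M \<and>
     (\<forall>i\<in>I. openin (top_of_set M) (U i) \<and> open (\<phi> i ` U i)) \<and>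
     (\<forall>i\<in>I. homeomorphism (U i) (\<phi> i ` U i) (\<phi> i) (inv_into (U i) (\<phi> i))) \<and>
     (\<forall>i\<in>I. \<forall>j\<in>I. C1_on (\<phi> j \<circ> inv_into (U i) (\<phi> i)) (\<phi> i ` (U i \<inter> U j)))"

definition holder_atlas ::
    "real \<Rightarrow> 'i set \<Rightarrow> ('i \<Rightarrow> 'a::banach set) \<Rightarrow> ('i \<Rightarrow> 'a \<Rightarrow> real ^ 'n) \<Rightarrow> bool" where
  "holder_atlas \<alpha> I U \<phi> \<longleftrightarrow>
     (\<exists>l. 0 < l \<and> l \<le> 1 \<and>
        (\<forall>i\<in>I. \<forall>x\<in>U i. \<forall>y\<in>U i. x \<noteq> y \<longrightarrow>
           norm (\<phi> i x - \<phi> i y) powr \<alpha> / norm (x - y) \<ge> l))"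

definition C1_map ::
    "'i set \<Rightarrow> ('i \<Rightarrow> 'a::banach set) \<Rightarrow> ('i \<Rightarrow> 'a \<Rightarrow> real ^ 'n) \<Rightarrow> ('a \<Rightarrow> 'b::banach) \<Rightarrow> bool" where
  "C1_map I U \<phi> F \<longleftrightarrow> (\<forall>i\<in>I. C1_on (F \<circ> inv_into (U i) (\<phi> i)) (\<phi> i ` U i))"

text \<open>The differential of \<open>F\<close> at \<open>x\<close> in the chart \<open>\<psi>\<close> on \<open>V\<close>, where \<open>x \<in> V\<close>; the tangent
  space at \<open>x\<close> is identified with \<open>real ^ 'n\<close> through that chart.\<close>

definition chart_differential ::
    "'a::banach set \<Rightarrow> ('a \<Rightarrow> real ^ 'n) \<Rightarrow> ('a \<Rightarrow> 'b::banach) \<Rightarrow> 'a \<Rightarrow> real ^ 'n \<Rightarrow> 'b" where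
  "chart_differential V \<psi> F x = frechet_derivative (F \<circ> inv_into V \<psi>) (at (\<psi> x))"

text \<open>A chart around \<open>x\<close> is quantified existentially: injectivity of the differential is
  independent of the chart.\<close>

definition injective_differential_at ::
    "'i set \<Rightarrow> ('i \<Rightarrow> 'a::banach set) \<Rightarrow> ('i \<Rightarrow> 'a \<Rightarrow> real ^ 'n) \<Rightarrow> ('a \<Rightarrow> 'b::banach) \<Rightarrow> 'a \<Rightarrow> bool"
  where
  "injective_differential_at I U \<phi> F x \<longleftrightarrow>
     (\<exists>i\<in>I. x \<in> U i \<and> inj (chart_differential (U i) (\<phi> i) F x))"

end

theory Submission
  imports Defs
begin

text \<open>The estimate says that the quotient \<open>dist x y / (dist (F x) (F y)) powr \<alpha>\<close> is bounded on
  \<open>K \<times> K\<close>. As \<open>K \<times> K\<close> is compact, it is enough to bound it near each pair \<open>(x, y)\<close>.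
  Off the diagonal \<open>F x \<noteq> F y\<close> by injectivity, so the quotient is continuous there
  (lemma \<open>compact_local_imp_global_inverse_Holder\<close>).

  Near a diagonal point \<open>(x, x)\<close> the quotient may be discontinuous, and there the immersion
  property enters. Let \<open>g = F \<circ> \<phi>\<inverse>\<close> be \<open>F\<close> in a chart \<open>\<phi>\<close> around \<open>x\<close>. Its differential at \<open>\<phi> x\<close> is
  injective on a finite-dimensional space, hence bounded below by some \<open>B > 0\<close>, and by
  continuity of the derivative \<open>g\<close> differs from a linear map by a map with Lipschitz constant
  \<open>B/2\<close> near \<open>\<phi> x\<close>. So \<open>g\<close> expands distances by at least \<open>B/2\<close> there
  (lemma \<open>C1_immersion_locally_expanding\<close>). Combined with the
  \<open>\<alpha>\<close>-Hoelder bound for \<open>\<phi>\<inverse>\<close>, this gives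
  \<open>dist y z \<le> const * \<bar>\<phi> y - \<phi> z\<bar> powr \<alpha> \<le> const * (dist (F y) (F z)) powr \<alpha>\<close>
  for \<open>y\<close> and \<open>z\<close> close to \<open>x\<close> (lemma \<open>local_inverse_Holder\<close>).\<close>

section \<open>\<open>C\<^sup>1\<close> immersions expand distances locally\<close>

text \<open>The bound is the minimum of the norm of \<open>L h\<close> over the unit sphere. It is positive because
  it is attained: the sphere is compact, as the domain is finite-dimensional.\<close>

lemma injective_blinfun_bounded_below:
  fixes L :: "'e::euclidean_space \<Rightarrow>\<^sub>L 'b::real_normed_vector"
  assumes "inj (blinfun_apply L)"
  obtains B where "B > 0" "\<And>h. B * norm h \<le> norm (L h)"
proof -
  have "continuous_on (sphere 0 1) (\<lambda>h. norm (L h))"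
    by (intro continuous_intros)
  moreover have "sphere (0::'e) 1 \<noteq> {}" "compact (sphere (0::'e) 1)"
    by simp_all
  ultimately obtain u where u: "u \<in> sphere 0 1"
    and least: "\<And>h. h \<in> sphere 0 1 \<Longrightarrow> norm (L u) \<le> norm (L h)"
    using continuous_attains_inf by metis
  have "L u \<noteq> L 0"
    using u injD[OF assms, of u 0] by force
  then have pos: "norm (L u) > 0"
    by (simp add: blinfun.zero_right)
  have "norm (L u) * norm h \<le> norm (L h)" for h
  proof (cases "h = 0")
    case False
    then have "norm (L u) \<le> norm (L (h /\<^sub>R norm h))"
      by (intro least) simp
    then show ?thesis
      using False by (simp add: blinfun.scaleR_right field_simps)
  qed simp
  with pos show ?thesis
    using that by blast
qed

text \<open>Near \<open>p\<close> the map \<open>g\<close> is the linear map \<open>g' p\<close> plus a perturbation whose Lipschitz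
  constant is at most half the lower bound of \<open>g' p\<close>, so the perturbation cannot cancel the
  expansion by \<open>g' p\<close>.\<close>

lemma C1_immersion_locally_expanding:
  fixes g :: "'e::euclidean_space \<Rightarrow> 'b::real_normed_vector"
  assumes C1: "C1_on g S" and "open S" and p: "p \<in> S"
    and inj: "inj (frechet_derivative g (at p))"
  obtains r c where "r > 0" "c > 0" "ball p r \<subseteq> S"
    "\<And>u v. \<lbrakk>u \<in> ball p r; v \<in> ball p r\<rbrakk> \<Longrightarrow> norm (u - v) \<le> c * norm (g u - g v)"
proof -
  obtain g' :: "'e \<Rightarrow> 'e \<Rightarrow>\<^sub>L 'b"
    where der: "\<And>u. u \<in> S \<Longrightarrow> (g has_derivative g' u) (at u)"
      and cont: "continuous_on S g'"
    using C1 unfolding C1_on_def by blast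
  have "inj (blinfun_apply (g' p))"
    using inj frechet_derivative_at[OF der[OF p]] by simp
  then obtain B where "B > 0" and B: "\<And>h. B * norm h \<le> norm (g' p h)"
    using injective_blinfun_bounded_below by blast
  have "isCont g' p"
    using cont \<open>open S\<close> p continuous_on_eq_continuous_at by blast
  then obtain d where "d > 0" and d: "\<And>u. dist u p < d \<Longrightarrow> dist (g' u) (g' p) < B / 2"
    using \<open>B > 0\<close> unfolding continuous_at_eps_delta by (meson half_gt_zero)
  obtain s where "s > 0" and s: "ball p s \<subseteq> S"
    using \<open>open S\<close> p open_contains_ball by blast
  define r where "r = min d s"
  have "r > 0" and sub: "ball p r \<subseteq> S"
    using \<open>d > 0\<close> \<open>s > 0\<close> s by (auto simp: r_def)
  have "norm (u - v) \<le> 2 / B * norm (g u - g v)" if uv: "u \<in> ball p r" "v \<in> ball p r" for u v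
  proof -
    have "norm (g u - g v - g' p (u - v)) \<le> norm (u - v) * (B / 2)"
    proof (rule differentiable_bound_linearization[where S = "ball p r" and f' = "\<lambda>w. g' w"])
      fix t :: real
      assume "t \<in> {0..1}"
      then have "v + t *\<^sub>R (u - v) \<in> closed_segment v u"
        by (auto simp: closed_segment_def algebra_simps intro!: exI[of _ t])
      then show "v + t *\<^sub>R (u - v) \<in> ball p r"
        using uv closed_segment_subset[OF uv(2,1) convex_ball] by blast
    next
      fix w
      assume w: "w \<in> ball p r"
      then show "(g has_derivative g' w) (at w within ball p r)"
        using der sub by (blast intro: has_derivative_at_withinI)
      have "dist (g' w) (g' p) \<le> B / 2"
        using w d[of w] by (simp add: r_def dist_commute)
      then show "onorm (blinfun_apply (g' w) - blinfun_apply (g' p)) \<le> B / 2"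
        by (simp add: dist_norm norm_blinfun.rep_eq minus_blinfun.rep_eq fun_diff_def)
    qed (use \<open>r > 0\<close> in simp)
    moreover have "norm (g' p (u - v)) \<le> norm (g u - g v) + norm (g u - g v - g' p (u - v))"
      by (metis norm_minus_commute norm_triangle_sub)
    ultimately have "B / 2 * norm (u - v) \<le> norm (g u - g v)"
      using B[of "u - v"] by (simp add: mult.commute)
    then show ?thesis
      using \<open>B > 0\<close> by (simp add: field_simps)
  qed
  then show ?thesis
    using that[of r "2 / B"] \<open>r > 0\<close> \<open>B > 0\<close> sub by simp
qed

section \<open>From local to global estimates on compact sets\<close>

lemma locally_bounded_above_imp_bounded_above:
  fixes h :: "'a::topological_space \<Rightarrow> real"
  assumes "compact S"
    and loc: "\<And>p. p \<in> S \<Longrightarrow> \<exists>T b. open T \<and> p \<in> T \<and> (\<forall>q\<in>S \<inter> T. h q \<le> b)"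
  shows "\<exists>b. \<forall>q\<in>S. h q \<le> b"
proof -
  obtain T b where T: "\<And>p. p \<in> S \<Longrightarrow> open (T p)" "\<And>p. p \<in> S \<Longrightarrow> p \<in> T p"
    and b: "\<And>p q. \<lbrakk>p \<in> S; q \<in> S \<inter> T p\<rbrakk> \<Longrightarrow> h q \<le> b p"
    using loc by metis
  then have "S \<subseteq> (\<Union>p\<in>S. T p)"
    by blast
  then obtain D where D: "D \<subseteq> S" "finite D" "S \<subseteq> (\<Union>p\<in>D. T p)"
    using compactE_image[OF \<open>compact S\<close>] T(1) by metis
  have "h q \<le> Max (b ` D)" if "q \<in> S" for q
  proof -
    have "q \<in> (\<Union>p\<in>D. T p)"
      using D(3) that by (rule subsetD)
    then obtain p where "p \<in> D" "q \<in> T p"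
      by (rule UN_E)
    then have "h q \<le> b p"
      using b D(1) that by blast
    also have "\<dots> \<le> Max (b ` D)"
      using D(2) \<open>p \<in> D\<close> by simp
    finally show ?thesis .
  qed
  then show ?thesis
    by blast
qed

text \<open>Passing from local to global: two points of \<open>K\<close> that are far apart satisfy the
  estimate because injectivity keeps their images apart.\<close>

lemma compact_local_imp_global_inverse_Holder:
  fixes F :: "'a::metric_space \<Rightarrow> 'b::metric_space"
  assumes "compact K" and cont: "continuous_on K F" and inj: "inj_on F K"
    and loc: "\<And>x. x \<in> K \<Longrightarrow> \<exists>T C. open T \<and> x \<in> T \<and>
      (\<forall>y\<in>K \<inter> T. \<forall>z\<in>K \<inter> T. dist y z \<le> C * dist (F y) (F z) powr \<alpha>)"
  shows "\<exists>C>0. \<forall>x\<in>K. \<forall>y\<in>K. dist x y \<le> C * dist (F x) (F y) powr \<alpha>"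
proof -
  \<comment> \<open>On the diagonal \<open>h\<close> takes the default value \<open>0 / 0 = 0\<close>, which is why the bound near a
      diagonal point is \<open>max C 0\<close>: nothing forces the local constant \<open>C\<close> to be nonnegative.\<close>
  define h where "h = (\<lambda>(x, y). dist x y / dist (F x) (F y) powr \<alpha>)"
  have "\<exists>b. \<forall>q\<in>K \<times> K. h q \<le> b"
  proof (rule locally_bounded_above_imp_bounded_above)
    show "compact (K \<times> K)"
      using \<open>compact K\<close> by (simp add: compact_Times)
    fix p
    assume "p \<in> K \<times> K"
    then obtain x y where p: "p = (x, y)" and x: "x \<in> K" and y: "y \<in> K"
      by blast
    show "\<exists>T b. open T \<and> p \<in> T \<and> (\<forall>q\<in>K \<times> K \<inter> T. h q \<le> b)"
    proof (cases "x = y")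
      case True
      obtain T C where T: "open T" "x \<in> T"
        and C: "\<And>y z. \<lbrakk>y \<in> K \<inter> T; z \<in> K \<inter> T\<rbrakk> \<Longrightarrow> dist y z \<le> C * dist (F y) (F z) powr \<alpha>"
        using loc[OF x] by blast
      have "h (y, z) \<le> max C 0" if yz: "y \<in> K \<inter> T" "z \<in> K \<inter> T" for y z
      proof (cases "F y = F z")
        case False
        then have "h (y, z) \<le> C"
          using C[OF yz] by (simp add: h_def divide_le_eq)
        then show ?thesis
          by simp
      qed (simp add: h_def)
      then show ?thesis
        using T p True by (intro exI[of _ "T \<times> T"] exI[of _ "max C 0"]) (auto intro: open_Times)
    next
      case False
      then have ne: "F x \<noteq> F y"
        using inj x y by (auto dest: inj_onD)
      have F1: "continuous_on (K \<times> K) (\<lambda>q. F (fst q))"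
        by (rule continuous_on_compose2[OF cont]) (auto intro: continuous_on_fst continuous_on_snd)
      have F2: "continuous_on (K \<times> K) (\<lambda>q. F (snd q))"
        by (rule continuous_on_compose2[OF cont]) (auto intro: continuous_on_fst continuous_on_snd)
      have lim1: "((\<lambda>q. F (fst q)) \<longlongrightarrow> F x) (at p within K \<times> K)"
        using F1 p x y by (auto simp: continuous_on_def)
      have lim2: "((\<lambda>q. F (snd q)) \<longlongrightarrow> F y) (at p within K \<times> K)"
        using F2 p x y by (auto simp: continuous_on_def)
      have fs: "(fst \<longlongrightarrow> x) (at p within K \<times> K)" "(snd \<longlongrightarrow> y) (at p within K \<times> K)"
        using p by (auto intro!: tendsto_eq_intros)
      have "((\<lambda>q. dist (fst q) (snd q) / dist (F (fst q)) (F (snd q)) powr \<alpha>)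
          \<longlongrightarrow> dist x y / dist (F x) (F y) powr \<alpha>) (at p within K \<times> K)"
        using ne by (intro tendsto_divide tendsto_dist tendsto_powr lim1 lim2 fs tendsto_const) auto
      then have "(h \<longlongrightarrow> h p) (at p within K \<times> K)"
        by (simp add: h_def p case_prod_unfold)
      then have "\<forall>\<^sub>F q in at p within K \<times> K. h q < h p + 1"
        by (rule order_tendstoD) simp
      then obtain T where "open T" "p \<in> T"
        and T: "\<And>q. \<lbrakk>q \<in> T; q \<noteq> p; q \<in> K \<times> K\<rbrakk> \<Longrightarrow> h q < h p + 1"
        unfolding eventually_at_topological by blast
      then have "h q \<le> h p + 1" if "q \<in> K \<times> K \<inter> T" for q
        using that by (cases "q = p") (auto intro: less_imp_le)
      then show ?thesis
        using \<open>open T\<close> \<open>p \<in> T\<close> by blast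
    qed
  qed
  then obtain b where b: "\<And>x y. \<lbrakk>x \<in> K; y \<in> K\<rbrakk> \<Longrightarrow> h (x, y) \<le> b"
    by blast
  have "dist x y \<le> max b 1 * dist (F x) (F y) powr \<alpha>" if "x \<in> K" "y \<in> K" for x y
  proof (cases "x = y")
    case False
    then have "0 < dist (F x) (F y) powr \<alpha>"
      using inj that by (auto dest: inj_onD)
    moreover have "dist x y / dist (F x) (F y) powr \<alpha> \<le> max b 1"
      using b[OF that] by (simp add: h_def)
    ultimately show ?thesis
      by (simp add: divide_le_eq)
  qed simp
  then show ?thesis
    by (intro exI[of _ "max b 1"]) auto
qed

section \<open>Estimates in the charts of a Hoelder manifold\<close>

lemma C1_on_imp_continuous_on: "C1_on f S \<Longrightarrow> continuous_on S f"
  unfolding C1_on_def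
  by (meson continuous_at_imp_continuous_on has_derivative_continuous)

lemma C1_map_imp_continuous_on:
  fixes \<phi> :: "'i \<Rightarrow> 'a::banach \<Rightarrow> real ^ 'n"
  assumes M: "differentiable_manifold M I U \<phi>" and F: "C1_map I U \<phi> F"
  shows "continuous_on M F"
proof (unfold continuous_on_eq_continuous_within, intro ballI)
  fix x
  assume "x \<in> M"
  then obtain i where i: "i \<in> I" and x: "x \<in> U i"
    using M by (auto simp: differentiable_manifold_def)
  have hom: "homeomorphism (U i) (\<phi> i ` U i) (\<phi> i) (inv_into (U i) (\<phi> i))"
    and "openin (top_of_set M) (U i)"
    using M i by (auto simp: differentiable_manifold_def)
  then obtain T where T: "open T" "U i = M \<inter> T"
    by (auto simp: openin_open)
  have "continuous_on (\<phi> i ` U i) (F \<circ> inv_into (U i) (\<phi> i))"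
    using F i unfolding C1_map_def by (blast intro: C1_on_imp_continuous_on)
  moreover have "continuous_on (U i) (\<phi> i)"
    using hom by (simp add: homeomorphism_def)
  ultimately have "continuous_on (U i) ((F \<circ> inv_into (U i) (\<phi> i)) \<circ> \<phi> i)"
    by (rule continuous_on_compose[rotated])
  moreover have "((F \<circ> inv_into (U i) (\<phi> i)) \<circ> \<phi> i) y = F y" if "y \<in> U i" for y
    using hom that by (simp add: homeomorphism_def)
  ultimately have "continuous_on (U i) F"
    by (simp cong: continuous_on_cong)
  moreover have "at x within U i = at x within M"
    using T x by (intro at_within_nhd[where S = T]) auto
  ultimately show "continuous (at x within M) F"
    using x by (metis continuous_on_eq_continuous_within continuous_within)
qed

text \<open>The expansion of \<open>F\<close> in the chart gives \<open>\<bar>\<phi> y - \<phi> z\<bar> \<le> c * norm (F y - F z)\<close>, and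
  raising it to the power \<open>\<alpha>\<close> feeds the Hoelder condition of the atlas.\<close>

lemma local_inverse_Holder:
  fixes \<phi> :: "'i \<Rightarrow> 'a::banach \<Rightarrow> real ^ 'n"
  assumes "0 < \<alpha>" and M: "differentiable_manifold M I U \<phi>" and "holder_atlas \<alpha> I U \<phi>"
    and F: "C1_map I U \<phi> F" and inj: "injective_differential_at I U \<phi> F x"
  shows "\<exists>T C. open T \<and> x \<in> T \<and>
    (\<forall>y\<in>M \<inter> T. \<forall>z\<in>M \<inter> T. norm (y - z) \<le> C * norm (F y - F z) powr \<alpha>)"
proof -
  obtain i where i: "i \<in> I" and x: "x \<in> U i"
    and "inj (frechet_derivative (F \<circ> inv_into (U i) (\<phi> i)) (at (\<phi> i x)))"
    using inj by (auto simp: injective_differential_at_def chart_differential_def)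
  define g where "g = F \<circ> inv_into (U i) (\<phi> i)"
  have inj_g: "inj (frechet_derivative g (at (\<phi> i x)))"
    unfolding g_def by fact
  have hom: "homeomorphism (U i) (\<phi> i ` U i) (\<phi> i) (inv_into (U i) (\<phi> i))"
    and Ui: "openin (top_of_set M) (U i)" and op: "open (\<phi> i ` U i)"
    using M i by (auto simp: differentiable_manifold_def)
  obtain l where "l > 0" and l: "\<And>y z. \<lbrakk>y \<in> U i; z \<in> U i; y \<noteq> z\<rbrakk>
      \<Longrightarrow> l \<le> norm (\<phi> i y - \<phi> i z) powr \<alpha> / norm (y - z)"
    using \<open>holder_atlas \<alpha> I U \<phi>\<close> i unfolding holder_atlas_def by metis
  have C1: "C1_on g (\<phi> i ` U i)"
    using F i by (simp add: C1_map_def g_def)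
  obtain r c where "r > 0" "c > 0"
    and c: "\<And>u v. \<lbrakk>u \<in> ball (\<phi> i x) r; v \<in> ball (\<phi> i x) r\<rbrakk> \<Longrightarrow> norm (u - v) \<le> c * norm (g u - g v)"
    by (rule C1_immersion_locally_expanding[OF C1 op imageI[OF x] inj_g]) blast
  have "openin (top_of_set (U i)) (U i \<inter> \<phi> i -` ball (\<phi> i x) r)"
    using hom by (intro continuous_openin_preimage_gen) (auto simp: homeomorphism_def)
  then have "openin (top_of_set M) (U i \<inter> \<phi> i -` ball (\<phi> i x) r)"
    using Ui by (rule openin_trans)
  then obtain T where "open T" and T: "U i \<inter> \<phi> i -` ball (\<phi> i x) r = M \<inter> T"
    by (auto simp: openin_open)
  have "norm (y - z) \<le> c powr \<alpha> / l * norm (F y - F z) powr \<alpha>"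
    if "y \<in> M \<inter> T" "z \<in> M \<inter> T" for y z
  proof (cases "y = z")
    case False
    have yz: "y \<in> U i" "z \<in> U i" "\<phi> i y \<in> ball (\<phi> i x) r" "\<phi> i z \<in> ball (\<phi> i x) r"
      using that T by auto
    have "g (\<phi> i y) = F y" "g (\<phi> i z) = F z"
      using hom yz by (auto simp: g_def homeomorphism_def)
    then have "norm (\<phi> i y - \<phi> i z) \<le> c * norm (F y - F z)"
      using c[OF yz(3,4)] by simp
    then have "norm (\<phi> i y - \<phi> i z) powr \<alpha> \<le> (c * norm (F y - F z)) powr \<alpha>"
      using \<open>0 < \<alpha>\<close> by (intro powr_mono2) auto
    also have "\<dots> = c powr \<alpha> * norm (F y - F z) powr \<alpha>"
      using \<open>c > 0\<close> by (simp add: powr_mult)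
    finally have "l * norm (y - z) \<le> c powr \<alpha> * norm (F y - F z) powr \<alpha>"
      using l[OF yz(1,2) False] False by (simp add: le_divide_eq)
    then show ?thesis
      using \<open>l > 0\<close> by (simp add: field_simps)
  qed simp
  moreover have "x \<in> T"
    using T x \<open>r > 0\<close> by auto
  ultimately show ?thesis
    using \<open>open T\<close> by blast
qed

theorem theorem2p2:
  fixes M K :: "'a::banach set"
    and I :: "'i set"
    and U :: "'i \<Rightarrow> 'a set"
    and \<phi> :: "'i \<Rightarrow> 'a \<Rightarrow> real ^ 'n"
    and F :: "'a \<Rightarrow> 'b::banach"
    and \<alpha> :: real
  assumes "0 < \<alpha>" and "\<alpha> \<le> 1"
    and "differentiable_manifold M I U \<phi>"
    and "holder_atlas \<alpha> I U \<phi>"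
    and "K \<subseteq> M" and "compact K"
    and "C1_map I U \<phi> F"
    and "inj_on F M"
    and "\<forall>x\<in>M. injective_differential_at I U \<phi> F x"
  shows "\<exists>C>0. \<forall>x\<in>K. \<forall>y\<in>K. norm (x - y) \<le> C * norm (F x - F y) powr \<alpha>"
proof -
  have "\<exists>C>0. \<forall>x\<in>K. \<forall>y\<in>K. dist x y \<le> C * dist (F x) (F y) powr \<alpha>"
  proof (rule compact_local_imp_global_inverse_Holder)
    show "continuous_on K F"
      using C1_map_imp_continuous_on assms continuous_on_subset by blast
    show "inj_on F K"
      using assms inj_on_subset by blast
    fix x
    assume "x \<in> K"
    then obtain T C where "open T" "x \<in> T"
      and "\<forall>y\<in>M \<inter> T. \<forall>z\<in>M \<inter> T. norm (y - z) \<le> C * norm (F y - F z) powr \<alpha>"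
      using local_inverse_Holder[OF assms(1,3,4,7)] \<open>K \<subseteq> M\<close> assms(9) by (metis subsetD)
    then show "\<exists>T C. open T \<and> x \<in> T \<and>
        (\<forall>y\<in>K \<inter> T. \<forall>z\<in>K \<inter> T. dist y z \<le> C * dist (F y) (F z) powr \<alpha>)"
      using \<open>K \<subseteq> M\<close> unfolding dist_norm by blast
  qed fact
  then show ?thesis
    by (simp add: dist_norm)
qed

end
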